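(* Let $A\in\mathcal{M}_\mu^i$ be bounded. Then for any positive integer $t^0$ and any $X\in\mathcal{V}_{t^0}$, the $A$-sequence of $X$ enters some $\mathcal{V}_t\in\mathcal{I}_A$ after finitely many steps; that is, there exist $k\ge0$ and $t\ge1$ such that $X_k\in\mathcal{V}_t$ and $\mathcal{V}_t$ is $A$-invariant.
   Context: Matrices and vectors are over a field $\mathbb{F}$ of characteristic $0$. For a positive rational $\mu=\mu_y/\mu_x$ with $\mu_y,\mu_x$ coprime positive integers, $\mathcal{M}_\mu^i:=\mathcal{M}_{i\mu_y\times i\mu_x}$, and $\mathcal{M}_\mu=\bigcup_{i\ge1}\mathcal{M}_\mu^i$. A matrix $A\in\mathcal{M}_\mu$ is called bounded if $\mu_y=1$. $\mathcal{V}_t=\mathbb{F}^t$ and $\mathcal{V}=\bigcup_{t\ge1}\mathcal{V}_t$ (vectors of different dimensions are different elements). For $A\in\mathcal{M}_{m\times n}$, $X\in\mathcal{V}_p$ and $s=\mathrm{lcm}(n,p)$, $A\,\vec{\ltimes}\,X:=(A\otimes I_{s/n})(X\otimes\mathbf{1}_{s/p})$, with $\otimes$ the Kronecker product and $\mathbf{1}_k\in\mathbb{F}^k$ the all-ones vector. $\mathcal{V}_t$ is $A$-invariant if $A\,\vec{\ltimes}\,X\in\mathcal{V}_t$ for all $X\in\mathcal{V}_t$; $\mathcal{I}_A:=\{\mathcal{V}_t:\mathcal{V}_t\text{ is }A\text{-invariant}\}$. The $A$-sequence of $X\in\mathcal{V}$ is $X_0=X$, $X_{j+1}=A\,\vec{\ltimes}\,X_j$,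 $j=0,1,2,\dots$. *)

theory Defs
  imports "Jordan_Normal_Form.Matrix"
begin

definition mat_kron :: "'a :: semiring_1 mat \<Rightarrow> 'a mat \<Rightarrow> 'a mat" where
  "mat_kron A B = mat (dim_row A * dim_row B) (dim_col A * dim_col B)
     (\<lambda>(i, j). A $$ (i div dim_row B, j div dim_col B) * B $$ (i mod dim_row B, j mod dim_col B))"

definition vec_kron :: "'a :: semiring_1 vec \<Rightarrow> 'a vec \<Rightarrow> 'a vec" where
  "vec_kron u v = vec (dim_vec u * dim_vec v) (\<lambda>i. u $ (i div dim_vec v) * v $ (i mod dim_vec v))"

definition ones_vec :: "nat \<Rightarrow> 'a :: semiring_1 vec" where
  "ones_vec k = vec k (\<lambda>_. 1)"

text \<open>For a positive rational, \<^const>\<open>quotient_of\<close> returns the coprime pair of positive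
  integers (numerator, denominator). The classes below are meant for positive ratios only.\<close>

definition ratio_y :: "rat \<Rightarrow> nat" where
  "ratio_y \<mu> = nat (fst (quotient_of \<mu>))"

definition ratio_x :: "rat \<Rightarrow> nat" where
  "ratio_x \<mu> = nat (snd (quotient_of \<mu>))"

definition ratio_mats_of :: "rat \<Rightarrow> nat \<Rightarrow> 'a mat set" where
  "ratio_mats_of \<mu> i = carrier_mat (i * ratio_y \<mu>) (i * ratio_x \<mu>)"

definition ratio_mats :: "rat \<Rightarrow> 'a mat set" where
  "ratio_mats \<mu> = (\<Union>i\<in>{1..}. ratio_mats_of \<mu> i)"

text \<open>The ratio is determined by the matrix, since both dimensions are positive.\<close>

definition bounded_mat :: "'a mat \<Rightarrow> bool" where
  "bounded_mat A \<longleftrightarrow> (\<exists>\<mu>>0. A \<in> ratio_mats \<mu> \<and> ratio_y \<mu> = 1)"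

definition vec_stp :: "'a :: field_char_0 mat \<Rightarrow> 'a vec \<Rightarrow> 'a vec" where
  "vec_stp A X = (let n = dim_col A; p = dim_vec X; s = lcm n p in
     mat_kron A (1\<^sub>m (s div n)) *\<^sub>v vec_kron X (ones_vec (s div p)))"

definition mat_invariant :: "'a :: field_char_0 mat \<Rightarrow> 'a vec set \<Rightarrow> bool" where
  "mat_invariant A V \<longleftrightarrow> (\<forall>X\<in>V. vec_stp A X \<in> V)"

definition invariant_spaces :: "'a :: field_char_0 mat \<Rightarrow> 'a vec set set" where
  "invariant_spaces A = {carrier_vec t | t. t \<ge> 1 \<and> mat_invariant A (carrier_vec t)}"

primrec mat_seq :: "'a :: field_char_0 mat \<Rightarrow> 'a vec \<Rightarrow> nat \<Rightarrow> 'a vec" where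
  "mat_seq A X 0 = X"
| "mat_seq A X (Suc j) = vec_stp A (mat_seq A X j)"

end

theory Submission
  imports Defs
begin

text \<open>
  Let the bounded matrix \<open>A\<close> have size \<open>m \<times> m d\<close>. One step replaces the dimension \<open>p\<close> of the
  current vector by \<open>lcm (m d) p / d\<close>, a multiple of \<open>m\<close>. If \<open>p\<close> is already a multiple
  of \<open>m\<close>, then \<open>lcm (m d) p\<close> divides \<open>p d\<close>, so the new dimension divides \<open>p\<close>. Hence the
  dimensions do not increase from the first step on, and they become stationary. A space
  whose dimension is unchanged by one step is invariant.
\<close>

text \<open>A matrix-vector product has as many entries as the matrix has rows, so only the row
  count of \<open>mat_kron\<close> matters; \<open>X\<close> enters through its dimension
  alone.\<close>

lemma dim_vec_stp:
  "dim_vec (vec_stp A X) = dim_row A * (lcm (dim_col A) (dim_vec X) div dim_col A)"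
  by (simp add: vec_stp_def mat_kron_def Let_def)

lemma dim_vec_stp_pos:
  assumes "0 < dim_row A" "0 < dim_col A" "0 < dim_vec X"
  shows "0 < dim_vec (vec_stp A X)"
proof -
  have "dim_col A \<le> lcm (dim_col A) (dim_vec X)"
    using assms by (intro dvd_imp_le dvd_lcm1 lcm_pos_nat)
  then show ?thesis
    using assms by (simp add: dim_vec_stp div_greater_zero_iff)
qed

lemma dim_row_dvd_dim_vec_stp: "dim_row A dvd dim_vec (vec_stp A X)"
  by (simp add: dim_vec_stp)

lemma dim_vec_stp_dvd:
  assumes "dim_row A dvd dim_col A" "0 < dim_col A" "dim_row A dvd dim_vec X"
  shows "dim_vec (vec_stp A X) dvd dim_vec X"
proof -
  define m where "m = dim_row A"
  define p where "p = dim_vec X"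
  obtain d where d: "dim_col A = m * d"
    using assms(1) unfolding m_def by (elim dvdE)
  have pos: "0 < m" "0 < d"
    using assms(2) d by simp_all
  obtain l where l: "lcm (m * d) p = m * d * l"
    using dvd_lcm1[of "m * d" p] by (elim dvdE)
  \<comment> \<open>\<open>p * d\<close> is a common multiple: of \<open>m * d\<close> because
    \<open>m\<close> divides \<open>p\<close>, and trivially of \<open>p\<close>.\<close>
  have "lcm (m * d) p dvd p * d"
    using assms(3) by (intro lcm_least mult_dvd_mono) (simp_all add: m_def p_def)
  then have "(m * l) * d dvd p * d"
    unfolding l by (simp only: ac_simps)
  then have "m * l dvd p"
    using pos by simp
  moreover have "dim_vec (vec_stp A X) = m * l"
    using pos unfolding dim_vec_stp d l m_def[symmetric] p_def[symmetric] by simp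
  ultimately show ?thesis
    unfolding p_def by simp
qed

text \<open>The dimension after one step is the same for all vectors of a given dimension, so a
  single \<open>X\<close> decides for its whole space.\<close>

lemma carrier_vec_in_invariant_spaces:
  fixes X :: "'a :: field_char_0 vec"
  assumes "0 < dim_vec X" "dim_vec (vec_stp A X) = dim_vec X"
  shows "carrier_vec (dim_vec X) \<in> invariant_spaces A"
proof -
  have "mat_invariant A (carrier_vec (dim_vec X))"
    unfolding mat_invariant_def
  proof
    fix Y :: "'a vec"
    assume "Y \<in> carrier_vec (dim_vec X)"
    then have "dim_vec (vec_stp A Y) = dim_vec (vec_stp A X)"
      by (simp only: dim_vec_stp carrier_vecD)
    with assms(2) show "vec_stp A Y \<in> carrier_vec (dim_vec X)"
      by (simp only: carrier_dim_vec)
  qed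
  then show ?thesis
    using assms(1) unfolding invariant_spaces_def Suc_le_eq[symmetric] by auto
qed

lemma mat_seq_enters_invariant_space:
  assumes "dim_row A dvd dim_col A" "0 < dim_col A" "0 < dim_vec X"
  shows "\<exists>k. 0 < dim_vec (mat_seq A X k) \<and>
    carrier_vec (dim_vec (mat_seq A X k)) \<in> invariant_spaces A"
proof -
  have "0 < dim_row A"
    using assms(1,2) by (auto intro: dvd_pos_nat)
  then have pos: "0 < dim_vec (mat_seq A X k)" for k
    using assms(2,3) by (induction k) (simp_all add: dim_vec_stp_pos)
  \<comment> \<open>The indices start at 1 because \<open>dim_row A\<close> need not divide
    \<open>dim_vec X\<close>, but it divides every later dimension.\<close>
  have decr: "dim_vec (mat_seq A X (Suc (Suc k))) \<le> dim_vec (mat_seq A X (Suc k))" for k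
    using dim_vec_stp_dvd[OF assms(1,2), of "mat_seq A X (Suc k)"] pos[of "Suc k"]
    by (simp add: dim_row_dvd_dim_vec_stp dvd_imp_le)
  \<comment> \<open>Stationarity is found at a minimum: an index \<open>Suc k\<close> of least
    dimension among the positive indices. The next dimension is then neither larger, by
    \<open>decr\<close>, nor smaller.\<close>
  obtain k where least: "\<And>j. dim_vec (mat_seq A X (Suc k)) \<le> dim_vec (mat_seq A X (Suc j))"
    using ex_has_least_nat[of "\<lambda>_. True" _ "\<lambda>j. dim_vec (mat_seq A X (Suc j))"] by auto
  have "dim_vec (vec_stp A (mat_seq A X (Suc k))) = dim_vec (mat_seq A X (Suc k))"
    using decr[of k] least[of "Suc k"] by simp
  then show ?thesis
    using pos carrier_vec_in_invariant_spaces by blast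
qed

text \<open>With \<open>ratio_y \<mu> = 1\<close> the matrix has size \<open>i\<close> by
  \<open>i * ratio_x \<mu>\<close>, and the denominator of a rational is positive.\<close>

lemma bounded_mat_dims:
  assumes "bounded_mat A"
  shows "dim_row A dvd dim_col A" "0 < dim_col A"
proof -
  obtain \<mu> i where "i \<ge> 1" "ratio_y \<mu> = 1" "A \<in> ratio_mats_of \<mu> i"
    using assms by (auto simp: bounded_mat_def ratio_mats_def)
  moreover have "0 < ratio_x \<mu>"
    by (simp add: ratio_x_def quotient_of_denom_pos')
  ultimately show "dim_row A dvd dim_col A" "0 < dim_col A"
    by (auto simp: ratio_mats_of_def)
qed

theorem theorem255:
  fixes A :: "'a :: field_char_0 mat" and \<mu> :: rat and i :: nat
  assumes "\<mu> > 0" and "i \<ge> 1" and "A \<in> ratio_mats_of \<mu> i" and "bounded_mat A"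
  shows "\<forall>t\<^sub>0\<ge>1. \<forall>X\<in>carrier_vec t\<^sub>0.
           \<exists>k t. t \<ge> 1 \<and> mat_seq A X k \<in> carrier_vec t \<and> carrier_vec t \<in> invariant_spaces A"
proof (intro allI impI ballI)
  fix t\<^sub>0 :: nat and X :: "'a vec"
  assume "t\<^sub>0 \<ge> 1" "X \<in> carrier_vec t\<^sub>0"
  then have "0 < dim_vec X"
    by auto
  from mat_seq_enters_invariant_space[OF bounded_mat_dims[OF assms(4)] this]
  obtain k where "0 < dim_vec (mat_seq A X k)"
    "carrier_vec (dim_vec (mat_seq A X k)) \<in> invariant_spaces A"
    by blast
  then show "\<exists>k t. t \<ge> 1 \<and> mat_seq A X k \<in> carrier_vec t \<and> carrier_vec t \<in> invariant_spaces A"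
    by (intro exI[of _ k] exI[of _ "dim_vec (mat_seq A X k)"]) auto
qed

end
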